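(* Every countable $\{K_3,\ K_1+2K_2,\ K_1+C_5,\ C_6\}$-free graph embeds into $\mathbb C_3$.
   Context: Graphs are simple and undirected. $G+H$ is the disjoint union, $2K_2=K_2+K_2$, $C_n$ is the $n$-cycle. $\mathcal F$-free means containing no member of $\mathcal F$ as an induced subgraph. $G$ embeds into $H$ if $G$ is isomorphic to an induced subgraph of $H$. $\mathbb C_3$ is the graph whose vertex set is a countable dense subset of the unit circle $S^1$ such that any two distinct points of it lie at a rational angle (in radians, hence never exactly $2\pi/3$), and $xy$ is an edge iff both circular arcs with end-points $x,y$ have length strictly larger than $1/3$ of the circumference (any such choice gives the same graph up to isomorphism). *)

theory Defs
  imports "HOL-Analysis.Analysis" "HOL-Library.Nat_Bijection"
begin

record 'a sgraph =
  verts :: "'a set"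
  edges :: "'a set set"

definition simple_graph :: "'a sgraph \<Rightarrow> bool" where
  "simple_graph G \<longleftrightarrow> edges G \<subseteq> {{u, v} |u v. u \<in> verts G \<and> v \<in> verts G \<and> u \<noteq> v}"

definition induced_sub :: "'a sgraph \<Rightarrow> 'a set \<Rightarrow> 'a sgraph" where
  "induced_sub G S = \<lparr>verts = S, edges = {e \<in> edges G. e \<subseteq> S}\<rparr>"

definition graph_iso :: "('a \<Rightarrow> 'b) \<Rightarrow> 'a sgraph \<Rightarrow> 'b sgraph \<Rightarrow> bool" where
  "graph_iso f G H \<longleftrightarrow> bij_betw f (verts G) (verts H) \<and>
     (\<forall>u\<in>verts G. \<forall>v\<in>verts G. {u, v} \<in> edges G \<longleftrightarrow> {f u, f v} \<in> edges H)"

definition isomorphic :: "'a sgraph \<Rightarrow> 'b sgraph \<Rightarrow> bool" where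
  "isomorphic G H \<longleftrightarrow> (\<exists>f. graph_iso f G H)"

definition embeds :: "'a sgraph \<Rightarrow> 'b sgraph \<Rightarrow> bool" where
  "embeds G H \<longleftrightarrow> (\<exists>S \<subseteq> verts H. isomorphic G (induced_sub H S))"

definition free_of :: "'b sgraph set \<Rightarrow> 'a sgraph \<Rightarrow> bool" where
  "free_of \<F> G \<longleftrightarrow> (\<forall>H\<in>\<F>. \<not> embeds H G)"

definition complete_graph :: "nat \<Rightarrow> nat sgraph" where
  "complete_graph n = \<lparr>verts = {..<n}, edges = {{i, j} |i j. i < n \<and> j < n \<and> i \<noteq> j}\<rparr>"

text \<open>Only meant for \<open>n \<ge> 3\<close>.\<close>

definition cycle_graph :: "nat \<Rightarrow> nat sgraph" where
  "cycle_graph n = \<lparr>verts = {..<n}, edges = {{i, (i + 1) mod n} |i. i < n}\<rparr>"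

text \<open>
  The disjoint union is carried back from \<open>nat + nat\<close> to \<open>nat\<close> along the bijection
  \<^const>\<open>sum_encode\<close>, so that graphs built with it can be members of one set.
\<close>

definition disj_union :: "nat sgraph \<Rightarrow> nat sgraph \<Rightarrow> nat sgraph" (infixr \<open>\<uplus>\<close> 65) where
  "G \<uplus> H =
     (let l = (\<lambda>x. sum_encode (Inl x)); r = (\<lambda>x. sum_encode (Inr x))
      in \<lparr>verts = l ` verts G \<union> r ` verts H,
          edges = (\<lambda>e. l ` e) ` edges G \<union> (\<lambda>e. r ` e) ` edges H\<rparr>)"

text \<open>
  Angles are understood modulo \<open>2\<pi>\<close>: two points lie at a rational angle if some rational
  rotation takes one to the other. Requiring the shorter arc between any two points to have
  rational length would be unsatisfiable for a dense set, since the three shorter arcs between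
  three points not contained in a half circle add up to \<open>2\<pi>\<close>.
\<close>

definition rational_circle_set :: "complex set \<Rightarrow> bool" where
  "rational_circle_set V \<longleftrightarrow>
     V \<subseteq> sphere 0 1 \<and> countable V \<and> sphere 0 1 \<subseteq> closure V \<and>
     (\<forall>x\<in>V. \<forall>y\<in>V. x \<noteq> y \<longrightarrow> (\<exists>q\<in>\<rat>. y = cis q * x))"

text \<open>The length of the counterclockwise arc of the unit circle from \<open>x\<close> to \<open>y\<close>.\<close>

definition arc_len :: "complex \<Rightarrow> complex \<Rightarrow> real" where
  "arc_len x y = Arg2pi (y / x)"

text \<open>The two arcs with distinct end-points \<open>x\<close>, \<open>y\<close> have lengths \<open>arc_len x y\<close> and \<open>arc_len y x\<close>.\<close>

definition circle_graph :: "complex set \<Rightarrow> complex sgraph" where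
  "circle_graph V =
     \<lparr>verts = V,
      edges = {{x, y} |x y. x \<in> V \<and> y \<in> V \<and> x \<noteq> y \<and>
                 arc_len x y > (2 * pi) / 3 \<and> arc_len y x > (2 * pi) / 3}\<rparr>"

lemma simple_graph_circle_graph: "simple_graph (circle_graph V)"
  unfolding simple_graph_def circle_graph_def by auto

lemma arc_len_add:
  assumes "x \<in> sphere 0 1" "y \<in> sphere 0 1" "x \<noteq> y"
  shows "arc_len x y + arc_len y x = 2 * pi"
proof -
  have x: "x \<noteq> 0" and y: "y \<noteq> 0" and n: "cmod (y / x) = 1"
    using assms by (auto simp: norm_divide)
  have nr: "\<not> (y / x \<in> \<real> \<and> 0 \<le> Re (y / x))"
  proof
    assume a: "y / x \<in> \<real> \<and> 0 \<le> Re (y / x)"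
    then obtain r where r: "y / x = complex_of_real r" by (auto elim: Reals_cases)
    with a n have "r = 1" by auto
    with r x assms(3) show False by auto
  qed
  have "Arg2pi (inverse (y / x)) = 2 * pi - Arg2pi (y / x)"
    using nr x y Arg2pi_eq_pi[of "y / x"] by (auto simp only: Arg2pi_inverse not_le split: if_splits)
  then show ?thesis by (simp add: arc_len_def field_simps)
qed

lemma rational_circle_set_exists: "rational_circle_set (cis ` \<rat>)"
proof -
  have "sphere 0 1 \<subseteq> closure (cis ` \<rat>)"
  proof
    fix z :: complex assume "z \<in> sphere 0 1"
    then have "z = cis (Arg2pi z)"
      using complex_norm_eq_1_exp[of z] by (simp add: cis_conv_exp)
    moreover have "cis ` closure \<rat> \<subseteq> closure (cis ` (\<rat> :: real set))"
      by (rule image_closure_subset[of _ cis]) (auto intro!: continuous_intros subsetD[OF closure_subset])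
    ultimately show "z \<in> closure (cis ` \<rat>)"
      unfolding Rats_closure_real by (metis UNIV_I image_subset_iff)
  qed
  moreover have "\<exists>q\<in>\<rat>. cis b = cis q * cis a" if "a \<in> \<rat>" "b \<in> \<rat>" for a b
    using that by (intro bexI[of _ "b - a"]) (auto simp: cis_mult)
  ultimately show ?thesis
    unfolding rational_circle_set_def by (auto simp: countable_rat)
qed

end

theory Submission
  imports Defs "HOL-Complex_Analysis.Great_Picard"
begin

text \<open>
  Cut the circle into three half-open arcs of equal length, numbered 0, 1, 2 counterclockwise, and
  describe a point by the number of its arc and its position inside the arc. Two points of the same
  arc are never adjacent, and for \<open>u\<close> in arc \<open>i\<close> and \<open>v\<close> in arc \<open>i + 1\<close> (modulo 3) the angle
  from \<open>u\<close> to \<open>v\<close> is a third of the full turn plus the difference of the positions, so that \<open>u\<close> and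
  \<open>v\<close> are adjacent iff the position of \<open>u\<close> is smaller than that of \<open>v\<close>. A graph is therefore
  represented by points of the circle as soon as its vertices have a colouring \<open>c\<close> with 3 colours and
  a strict order such that, for \<open>c v = c u + 1\<close>, the vertex \<open>u\<close> precedes \<open>v\<close> if they are adjacent and
  follows \<open>v\<close> if they are not. A partial order is enough: the positions are chosen one vertex after
  the other in a dense set, and transitivity always leaves room for the next vertex
  (\<open>countable_order_into_dense\<close>, \<open>circle_realisation\<close>).

  The colouring prescribes the order between vertices of different colours, that is, a multipartite
  tournament. It extends to an order iff it has no directed 3-cycle and no directed 4-cycle on two
  colours (\<open>tournament_order\<close>). A directed 3-cycle is either a triangle of the graph or an
  independent set with one vertex of each colour, and a directed 4-cycle on two colours is a $2K_2$
  between two colour classes. So what is needed is a proper 3-colouring without rainbow independent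
  triples such that any two classes induce a $2K_2$-free graph; such colourings are called cyclic.

  In a finite graph without the four forbidden subgraphs, a cyclic colouring is found by looking from
  one vertex \<open>x\<close> whose neighbourhood has the least number of elements. Its neighbours form one
  class. The graph \<open>M\<close> on the other vertices, including \<open>x\<close>, is bipartite and $2K_2$-free: it has no
  triangle, and \<open>x\<close> completes every $2K_2$ and every $C_5$ in it to a forbidden subgraph, while longer
  odd cycles without chords contain $2K_2$. For a vertex \<open>a\<close> of largest degree in
  \<open>M\<close>, the neighbours of \<open>a\<close> in \<open>M\<close> and the rest of \<open>M\<close> are the other two classes. Minimality of \<open>x\<close> makes
  all isolated vertices of \<open>M\<close> twins of \<open>x\<close>, and the remaining conditions follow from the absence of
  $C_6$, of $K_1+2K_2$ and of triangles (\<open>finite_cyclic_colouring\<close>). A countable graph need not have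
  vertices \<open>x\<close> and \<open>a\<close> of this kind, but being cyclic is a condition on at most four vertices at a
  time, so compactness gives a cyclic colouring there too (\<open>cyclic_colouring_countable\<close>).
\<close>

section \<open>Forbidden patterns as conditions on the adjacency relation\<close>

lemma embedsI:
  assumes "inj_on f (verts H)" "f ` verts H \<subseteq> verts G"
    and "\<And>u v. u \<in> verts H \<Longrightarrow> v \<in> verts H \<Longrightarrow> {u, v} \<in> edges H \<longleftrightarrow> {f u, f v} \<in> edges G"
  shows "embeds H G"
  unfolding embeds_def isomorphic_def
proof (intro exI conjI)
  show "graph_iso f H (induced_sub G (f ` verts H))"
    using assms by (auto simp: graph_iso_def induced_sub_def bij_betw_def)
qed (rule assms(2))

text \<open>
  For graphs on natural numbers it suffices to compare pairs with \<open>u < v\<close>; this halves the number of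
  cases when the graph is given by listing its vertices and edges.
\<close>

lemma embeds_nat_graphI:
  fixes H :: "nat sgraph"
  assumes "simple_graph G" and H: "\<forall>u\<in>verts H. {u} \<notin> edges H"
    and f: "\<forall>u\<in>verts H. f u \<in> verts G"
    and adj: "\<forall>u\<in>verts H. \<forall>v\<in>verts H. u < v \<longrightarrow>
      f u \<noteq> f v \<and> ({u, v} \<in> edges H \<longleftrightarrow> {f u, f v} \<in> edges G)"
  shows "embeds H G"
proof (rule embedsI)
  show "inj_on f (verts H)"
    using adj by (intro linorder_inj_onI') auto
  show "f ` verts H \<subseteq> verts G"
    using f by auto
  fix u v assume uv: "u \<in> verts H" "v \<in> verts H"
  have G: "{x} \<notin> edges G" for x
    using assms(1) by (auto simp: simple_graph_def doubleton_eq_iff)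
  consider "u < v" | "v < u" | "u = v" by linarith
  then show "{u, v} \<in> edges H \<longleftrightarrow> {f u, f v} \<in> edges G"
  proof cases
    case 1
    then show ?thesis using adj uv by simp
  next
    case 2
    then show ?thesis using adj uv insert_commute[of u v "{}"] insert_commute[of "f u" "f v" "{}"] by metis
  next
    case 3
    then show ?thesis using H G uv by simp
  qed
qed

text \<open>
  The vertices in the patterns are not required to be distinct: in each of the four graphs no two
  vertices have the same neighbours, so for a symmetric relation without loops equal vertices would
  contradict the prescribed adjacencies and non-adjacencies.
\<close>

definition triangle_free :: "('a \<Rightarrow> 'a \<Rightarrow> bool) \<Rightarrow> 'a set \<Rightarrow> bool" where
  "triangle_free E S \<longleftrightarrow> (\<forall>x y z. {x, y, z} \<subseteq> S \<longrightarrow> \<not> (E x y \<and> E y z \<and> E x z))"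

definition K1_2K2_free :: "('a \<Rightarrow> 'a \<Rightarrow> bool) \<Rightarrow> 'a set \<Rightarrow> bool" where
  "K1_2K2_free E S \<longleftrightarrow> (\<forall>x a b c d. {x, a, b, c, d} \<subseteq> S \<longrightarrow> \<not> (E a b \<and> E c d \<and>
      \<not> E x a \<and> \<not> E x b \<and> \<not> E x c \<and> \<not> E x d \<and>
      \<not> E a c \<and> \<not> E a d \<and> \<not> E b c \<and> \<not> E b d))"

definition K1_C5_free :: "('a \<Rightarrow> 'a \<Rightarrow> bool) \<Rightarrow> 'a set \<Rightarrow> bool" where
  "K1_C5_free E S \<longleftrightarrow> (\<forall>x a b c d e. {x, a, b, c, d, e} \<subseteq> S \<longrightarrow>
      \<not> (E a b \<and> E b c \<and> E c d \<and> E d e \<and> E e a \<and>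
         \<not> E x a \<and> \<not> E x b \<and> \<not> E x c \<and> \<not> E x d \<and> \<not> E x e \<and>
         \<not> E a c \<and> \<not> E b d \<and> \<not> E c e \<and> \<not> E d a \<and> \<not> E e b))"

definition C6_free :: "('a \<Rightarrow> 'a \<Rightarrow> bool) \<Rightarrow> 'a set \<Rightarrow> bool" where
  "C6_free E S \<longleftrightarrow> (\<forall>a b c d e f. {a, b, c, d, e, f} \<subseteq> S \<longrightarrow>
      \<not> (E a b \<and> E b c \<and> E c d \<and> E d e \<and> E e f \<and> E f a \<and>
         \<not> E a c \<and> \<not> E a d \<and> \<not> E a e \<and> \<not> E b d \<and> \<not> E b e \<and> \<not> E b f \<and>
         \<not> E c e \<and> \<not> E c f \<and> \<not> E d f))"

definition pattern_free :: "('a \<Rightarrow> 'a \<Rightarrow> bool) \<Rightarrow> 'a set \<Rightarrow> bool" where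
  "pattern_free E S \<longleftrightarrow> triangle_free E S \<and> K1_2K2_free E S \<and> K1_C5_free E S \<and> C6_free E S"

lemma pattern_free_subset:
  assumes "pattern_free E S" "F \<subseteq> S"
  shows "pattern_free E F"
proof -
  have "X \<subseteq> S" if "X \<subseteq> F" for X
    using assms(2) that by (rule order_trans[rotated])
  note sub = this
  note free = assms(1)[unfolded pattern_free_def]
  have "triangle_free E F"
    unfolding triangle_free_def
    by (intro allI impI, rule free[THEN conjunct1, unfolded triangle_free_def, rule_format], rule sub)
  moreover have "K1_2K2_free E F"
    unfolding K1_2K2_free_def
    by (intro allI impI, rule free[THEN conjunct2, THEN conjunct1, unfolded K1_2K2_free_def, rule_format],
        rule sub)
  moreover have "K1_C5_free E F"
    unfolding K1_C5_free_def
    by (intro allI impI, rule free[THEN conjunct2, THEN conjunct2, THEN conjunct1,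
          unfolded K1_C5_free_def, rule_format], rule sub)
  moreover have "C6_free E F"
    unfolding C6_free_def
    by (intro allI impI, rule free[THEN conjunct2, THEN conjunct2, THEN conjunct2,
          unfolded C6_free_def, rule_format], rule sub)
  ultimately show ?thesis
    by (simp add: pattern_free_def)
qed

lemma pattern_free_edges:
  assumes "simple_graph G"
    and "free_of {complete_graph 3,
                  complete_graph 1 \<uplus> (complete_graph 2 \<uplus> complete_graph 2),
                  complete_graph 1 \<uplus> cycle_graph 5,
                  cycle_graph 6} G"
  shows "pattern_free (\<lambda>u v. {u, v} \<in> edges G) (verts G)"
proof -
  define E where "E u v \<longleftrightarrow> {u, v} \<in> edges G" for u v
  have irr: "\<not> E u u" for u
    using assms(1) by (auto simp: E_def simple_graph_def doubleton_eq_iff)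
  have sym: "E u v \<longleftrightarrow> E v u" for u v
    by (simp add: E_def insert_commute)
  have free: "\<not> embeds (complete_graph 3) G"
      "\<not> embeds (complete_graph 1 \<uplus> (complete_graph 2 \<uplus> complete_graph 2)) G"
      "\<not> embeds (complete_graph 1 \<uplus> cycle_graph 5) G" "\<not> embeds (cycle_graph 6) G"
    using assms(2) by (auto simp: free_of_def)
  have K: "complete_graph (Suc 0) = \<lparr>verts = {0}, edges = {}\<rparr>"
      "complete_graph 2 = \<lparr>verts = {0, 1}, edges = {{0, 1}}\<rparr>"
      "complete_graph 3 = \<lparr>verts = {0, 1, 2}, edges = {{0, 1}, {1, 2}, {0, 2}}\<rparr>"
    by (auto simp: complete_graph_def less_Suc_eq numeral_2_eq_2 numeral_3_eq_3)
  have lt: "{..<5} = {0, 1, 2, 3, 4 :: nat}" "{..<6} = {0, 1, 2, 3, 4, 5 :: nat}"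
    by auto
  have C: "cycle_graph 5 = \<lparr>verts = {0, 1, 2, 3, 4}, edges = {{0, 1}, {1, 2}, {2, 3}, {3, 4}, {4, 0}}\<rparr>"
      "cycle_graph 6 = \<lparr>verts = {0, 1, 2, 3, 4, 5}, edges = {{0, 1}, {1, 2}, {2, 3}, {3, 4}, {4, 5}, {5, 0}}\<rparr>"
    unfolding cycle_graph_def setcompr_eq_image lessThan_def[symmetric] lt
    by (simp_all del: One_nat_def)
  \<comment> \<open>The left and right summands of \<open>\<uplus>\<close> become even and odd numbers. The numbers in between
    that are not vertices account for the entries \<open>undefined\<close> in the lists further down.\<close>
  have D: "complete_graph 1 \<uplus> (complete_graph 2 \<uplus> complete_graph 2) =
        \<lparr>verts = {0, 1, 5, 3, 7}, edges = {{1, 5}, {3, 7}}\<rparr>"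
      "complete_graph 1 \<uplus> cycle_graph 5 =
        \<lparr>verts = {0, 1, 3, 5, 7, 9}, edges = {{1, 3}, {3, 5}, {5, 7}, {7, 9}, {9, 1}}\<rparr>"
    by (auto simp: disj_union_def K C sum_encode_def)
  have "triangle_free E (verts G)"
    unfolding triangle_free_def
  proof (intro allI impI notI)
    fix x y z
    assume S: "{x, y, z} \<subseteq> verts G" and *: "E x y \<and> E y z \<and> E x z"
    then have d: "distinct [x, y, z]"
      using irr by auto
    have "embeds (complete_graph 3) G"
      unfolding K
      by (rule embeds_nat_graphI[where f = "\<lambda>i. [x, y, z] ! i", OF assms(1)])
         (use S d * in \<open>simp_all add: sym doubleton_eq_iff flip: E_def\<close>)
    with free show False by simp
  qed
  moreover have "K1_2K2_free E (verts G)"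
    unfolding K1_2K2_free_def
  proof (intro allI impI notI)
    fix x a b c d
    assume S: "{x, a, b, c, d} \<subseteq> verts G"
      and *: "E a b \<and> E c d \<and> \<not> E x a \<and> \<not> E x b \<and> \<not> E x c \<and> \<not> E x d \<and>
        \<not> E a c \<and> \<not> E a d \<and> \<not> E b c \<and> \<not> E b d"
    have d: "distinct [x, a, c, b, d]"
      using * irr by (auto simp: sym)
    have "embeds (complete_graph 1 \<uplus> (complete_graph 2 \<uplus> complete_graph 2)) G"
      unfolding D
      by (rule embeds_nat_graphI[where f = "\<lambda>i. [x, a, undefined, c, undefined, b, undefined, d] ! i", OF assms(1)])
         (use S d * in \<open>simp_all add: sym doubleton_eq_iff flip: E_def\<close>)
    with free show False by simp
  qed
  moreover have "K1_C5_free E (verts G)"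
    unfolding K1_C5_free_def
  proof (intro allI impI notI)
    fix x a b c d e
    assume S: "{x, a, b, c, d, e} \<subseteq> verts G"
      and *: "E a b \<and> E b c \<and> E c d \<and> E d e \<and> E e a \<and>
         \<not> E x a \<and> \<not> E x b \<and> \<not> E x c \<and> \<not> E x d \<and> \<not> E x e \<and>
         \<not> E a c \<and> \<not> E b d \<and> \<not> E c e \<and> \<not> E d a \<and> \<not> E e b"
    have d: "distinct [x, a, b, c, d, e]"
      using * irr by (auto simp: sym)
    have "embeds (complete_graph 1 \<uplus> cycle_graph 5) G"
      unfolding D
      by (rule embeds_nat_graphI[where f = "\<lambda>i. [x, a, undefined, b, undefined, c, undefined, d, undefined, e] ! i", OF assms(1)])
         (use S d * in \<open>simp_all add: sym doubleton_eq_iff flip: E_def\<close>)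
    with free show False by simp
  qed
  moreover have "C6_free E (verts G)"
    unfolding C6_free_def
  proof (intro allI impI notI)
    fix a b c d e f
    assume S: "{a, b, c, d, e, f} \<subseteq> verts G"
      and *: "E a b \<and> E b c \<and> E c d \<and> E d e \<and> E e f \<and> E f a \<and>
        \<not> E a c \<and> \<not> E a d \<and> \<not> E a e \<and> \<not> E b d \<and> \<not> E b e \<and> \<not> E b f \<and>
        \<not> E c e \<and> \<not> E c f \<and> \<not> E d f"
    have d: "distinct [a, b, c, d, e, f]"
      using * irr by (auto simp: sym)
    have "embeds (cycle_graph 6) G"
      unfolding C
      by (rule embeds_nat_graphI[where f = "\<lambda>i. [a, b, c, d, e, f] ! i", OF assms(1)])
         (use S d * in \<open>simp_all add: sym doubleton_eq_iff flip: E_def\<close>)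
    with free show False by simp
  qed
  ultimately show ?thesis
    unfolding E_def[abs_def] by (simp add: pattern_free_def)
qed

section \<open>Cyclic colourings\<close>

text \<open>
  These are the colourings by the three arcs of the circle. The last two conditions exclude $2K_2$
  between two classes and independent triples with one vertex in each class.
\<close>

definition cyclic_colouring :: "('a \<Rightarrow> 'a \<Rightarrow> bool) \<Rightarrow> 'a set \<Rightarrow> ('a \<Rightarrow> nat) \<Rightarrow> bool" where
  "cyclic_colouring E S c \<longleftrightarrow>
     (\<forall>x\<in>S. c x < 3) \<and>
     (\<forall>x\<in>S. \<forall>y\<in>S. E x y \<longrightarrow> c x \<noteq> c y) \<and>
     (\<forall>a b a' b'. {a, b, a', b'} \<subseteq> S \<longrightarrow> c a = c a' \<longrightarrow> c b = c b' \<longrightarrow> E a b \<longrightarrow> E a' b' \<longrightarrow>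
        E a b' \<or> E a' b) \<and>
     (\<forall>x y z. {x, y, z} \<subseteq> S \<longrightarrow> c x \<noteq> c y \<longrightarrow> c y \<noteq> c z \<longrightarrow> c x \<noteq> c z \<longrightarrow>
        E x y \<or> E y z \<or> E x z)"

lemma cyclic_colouringI:
  assumes "\<And>x. x \<in> S \<Longrightarrow> c x < 3"
    and "\<And>x y. x \<in> S \<Longrightarrow> y \<in> S \<Longrightarrow> E x y \<Longrightarrow> c x \<noteq> c y"
    and "\<And>a b a' b'. {a, b, a', b'} \<subseteq> S \<Longrightarrow> c a = c a' \<Longrightarrow> c b = c b' \<Longrightarrow> E a b \<Longrightarrow> E a' b' \<Longrightarrow>
      E a b' \<or> E a' b"
    and "\<And>x y z. {x, y, z} \<subseteq> S \<Longrightarrow> c x \<noteq> c y \<Longrightarrow> c y \<noteq> c z \<Longrightarrow> c x \<noteq> c z \<Longrightarrow> E x y \<or> E y z \<or> E x z"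
  shows "cyclic_colouring E S c"
  unfolding cyclic_colouring_def by (intro conjI allI ballI impI) (rule assms; assumption)+

lemma cyclic_colouringD:
  assumes "cyclic_colouring E S c"
  shows "x \<in> S \<Longrightarrow> c x < 3"
    and "x \<in> S \<Longrightarrow> y \<in> S \<Longrightarrow> E x y \<Longrightarrow> c x \<noteq> c y"
    and "{a, b, a', b'} \<subseteq> S \<Longrightarrow> c a = c a' \<Longrightarrow> c b = c b' \<Longrightarrow> E a b \<Longrightarrow> E a' b' \<Longrightarrow> E a b' \<or> E a' b"
    and "{x, y, z} \<subseteq> S \<Longrightarrow> c x \<noteq> c y \<Longrightarrow> c y \<noteq> c z \<Longrightarrow> c x \<noteq> c z \<Longrightarrow> E x y \<or> E y z \<or> E x z"
  using assms unfolding cyclic_colouring_def by presburger+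

text \<open>
  Think of \<open>x\<close> as the first point of arc 0. Its neighbours fill arc 1, and the set \<open>M\<close> of its
  non-neighbours, which contains \<open>x\<close>, is to be distributed over arcs 0 and 2. On the circle a point
  of arc 0 adjacent to as much as possible of arc 2 is adjacent to all points of arc 2 that have any
  neighbour in arc 0; this is the reason for splitting \<open>M\<close> by adjacency to \<open>a\<close>.
\<close>

lemma finite_cyclic_colouring:
  assumes "finite S" and free: "pattern_free E S"
    and sym: "\<And>u v. E u v \<longleftrightarrow> E v u"
  shows "\<exists>c. cyclic_colouring E S c"
proof (cases "S = {}")
  case True
  then show ?thesis by (auto simp: cyclic_colouring_def)
next
  case False
  have symI: "E v u" if "E u v" for u v
    using sym that by blast
  have tri: "\<not> E u w" if "u \<in> S" "v \<in> S" "w \<in> S" "E u v" "E v w" for u v w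
    using free[unfolded pattern_free_def triangle_free_def, THEN conjunct1, rule_format, of u v w] that
    by simp
  have irr: "\<not> E u u" if "u \<in> S" for u
    using tri[of u u u] that by blast
  note k2 = free[unfolded pattern_free_def K1_2K2_free_def, THEN conjunct2, THEN conjunct1, rule_format]
  note c5 = free[unfolded pattern_free_def K1_C5_free_def,
      THEN conjunct2, THEN conjunct2, THEN conjunct1, rule_format]
  note c6 = free[unfolded pattern_free_def C6_free_def,
      THEN conjunct2, THEN conjunct2, THEN conjunct2, rule_format]
  define N where "N u = {v \<in> S. E u v}" for u
  obtain x where x: "x \<in> S" "\<And>y. y \<in> S \<Longrightarrow> card (N x) \<le> card (N y)"
  proof -
    have "Min ((\<lambda>u. card (N u)) ` S) \<in> (\<lambda>u. card (N u)) ` S"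
      using assms(1) False by (intro Min_in) auto
    then obtain x where x: "x \<in> S" "Min ((\<lambda>u. card (N u)) ` S) = card (N x)"
      by auto
    show thesis
      using that[OF x(1)] assms(1) by (simp flip: x(2))
  qed
  define M where "M = S - N x"
  have MS: "u \<in> S" "\<not> E x u" "\<not> E u x" if "u \<in> M" for u
    using that sym by (auto simp: M_def N_def)
  have NS: "u \<in> S" "E x u" "E u x" if "u \<in> N x" for u
    using that sym by (auto simp: N_def)
  have xM: "x \<in> M"
    using x irr by (auto simp: M_def N_def)
  \<comment> \<open>A vertex of \<open>M\<close> that is isolated in \<open>M\<close> has all its neighbours in \<open>N x\<close>, and by the
    minimality of \<open>N x\<close> it then has the same neighbours as \<open>x\<close>.\<close>
  have twin: "E v p" if v: "v \<in> M" "\<And>w. w \<in> M \<Longrightarrow> \<not> E v w" and p: "p \<in> N x" for v p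
  proof -
    have "N v \<subseteq> N x" using v by (auto simp: M_def N_def)
    then have "N v = N x"
      using x(2)[of v] MS[OF v(1)] assms(1) by (intro card_seteq) (auto simp: N_def)
    with p show ?thesis by (auto simp: N_def)
  qed
  \<comment> \<open>Otherwise \<open>x\<close> and the two edges form a copy of $K_1+2K_2$.\<close>
  have chain: "E u u' \<or> E u v' \<or> E v u' \<or> E v v'"
    if "u \<in> M" "v \<in> M" "u' \<in> M" "v' \<in> M" "E u v" "E u' v'" for u v u' v'
    using k2[of x u v u' v'] x(1) MS(1,2) that by auto
  define R where "R u = {v \<in> M. E u v}" for u
  have finR: "finite (R u)" for u
    using assms(1) by (auto simp: R_def M_def)
  obtain a where a: "a \<in> M" "\<And>y. y \<in> M \<Longrightarrow> card (R y) \<le> card (R a)"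
  proof -
    have "finite M" using assms(1) by (simp add: M_def)
    have "Max ((\<lambda>u. card (R u)) ` M) \<in> (\<lambda>u. card (R u)) ` M"
      using \<open>finite M\<close> xM by (intro Max_in) auto
    then obtain a where a: "a \<in> M" "Max ((\<lambda>u. card (R u)) ` M) = card (R a)"
      by auto
    show thesis
      using that[OF a(1)] \<open>finite M\<close> by (simp flip: a(2))
  qed
  \<comment> \<open>Every neighbour of \<open>a\<close> in \<open>M\<close> is adjacent to \<open>u\<close> or to \<open>v\<close>. By the maximality of \<open>a\<close> some
    neighbour \<open>w\<close> misses \<open>u\<close> and some neighbour \<open>w'\<close> misses \<open>v\<close>, so that \<open>a w v u w'\<close> is a
    5-cycle, to which \<open>x\<close> is not adjacent.\<close>
  have L: False if uv: "u \<in> M" "v \<in> M" "\<not> E a u" "\<not> E a v" "E u v" for u v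
  proof -
    have ex: "\<exists>w\<in>M. E a w \<and> \<not> E u w" if uv: "u \<in> M" "v \<in> M" "\<not> E a u" "\<not> E a v" "E u v" for u v
    proof (rule ccontr)
      assume "\<not> ?thesis"
      then have "R a \<subset> R u" using uv by (auto simp: R_def)
      from psubset_card_mono[OF finR this] a(2)[OF uv(1)] show False by simp
    qed
    obtain w where w: "w \<in> M" "E a w" "\<not> E u w" using ex[OF uv] by blast
    obtain w' where w': "w' \<in> M" "E a w'" "\<not> E v w'"
      using ex[OF uv(2,1,4,3) symI[OF uv(5)]] by blast
    have vw: "E v w"
      using chain[OF a(1) w(1) uv(1,2) w(2) uv(5)] uv(3,4) w(3) symI by metis
    have uw: "E u w'"
      using chain[OF a(1) w'(1) uv(1,2) w'(2) uv(5)] uv(3,4) w'(3) symI by metis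
    have S: "a \<in> S" "u \<in> S" "v \<in> S" "w \<in> S" "w' \<in> S"
      using MS(1) a(1) uv w w' by auto
    have ww: "\<not> E w' w"
      by (rule tri[OF S(5,1,4)]) (use w w' symI in auto)
    have "\<not> E x t" if "t \<in> {a, u, v, w, w'}" for t
      using MS(2) a(1) uv w w' that by auto
    then show False
      using c5[of x a w v u w'] x(1) S uv(3,4,5) w(2,3) w'(2,3) vw uw ww by (simp add: sym)
  qed
  define c where "c v = (if v \<in> N x then 1 else if E a v then 2 else 0 :: nat)" for v
  have c1: "c v = 1 \<longleftrightarrow> v \<in> N x" for v
    by (simp add: c_def)
  have cM: "c v \<noteq> c w" if "v \<in> M" "w \<in> M" "E v w" for v w
  proof -
    have "E a v \<longleftrightarrow> \<not> E a w"
      using L[OF that(1,2)] tri[OF MS(1)[OF a(1)] MS(1)[OF that(1)] MS(1)[OF that(2)]] that(3) by blast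
    then show ?thesis
      using that(1,2) by (auto simp: c_def M_def)
  qed
  have cM2: "c v = c w" if "u \<in> M" "v \<in> M" "w \<in> M" "c u \<noteq> c v" "c u \<noteq> c w" for u v w
    using that by (auto simp: c_def M_def split: if_splits)
  have proper: "c u \<noteq> c v" if "u \<in> S" "v \<in> S" "E u v" for u v
  proof (cases "u \<in> M \<and> v \<in> M")
    case False
    show ?thesis
    proof
      assume "c u = c v"
      with False that(1,2) have "u \<in> N x" "v \<in> N x"
        unfolding M_def using c1[of u] c1[of v] by auto
      with tri[OF that(1) x(1) that(2)] NS(2,3) that(3) show False by blast
    qed
  next
    case True
    then show ?thesis using cM that(3) by blast
  qed
  \<comment> \<open>Since \<open>q\<close> and \<open>q'\<close> are not twins of \<open>x\<close>, both have neighbours in \<open>M\<close>, and by \<open>chain\<close> a common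
    one, \<open>r\<close>. Then \<open>x p q r q' p'\<close> would be an induced 6-cycle.\<close>
  have cross: "E p q' \<or> E p' q"
    if pq: "p \<in> N x" "p' \<in> N x" "q \<in> M" "q' \<in> M" "c q = c q'" "E p q" "E p' q'" for p p' q q'
  proof (rule ccontr)
    assume *: "\<not> ?thesis"
    obtain w where w: "w \<in> M" "E q w" using twin[OF pq(3) _ pq(2)] * symI by blast
    obtain w' where w': "w' \<in> M" "E q' w'" using twin[OF pq(4) _ pq(1)] * symI by blast
    have "c w = c w'"
      using cM2[OF pq(3) w(1) w'(1)] cM[OF pq(3) w] cM[OF pq(4) w'] pq(5) by simp
    then have "E q w' \<or> E w q'"
      using chain[OF pq(3) w(1) pq(4) w'(1) w(2) w'(2)] cM[OF pq(3,4)] cM[OF w(1) w'(1)] pq(5) by blast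
    then obtain r where r: "r \<in> M" "E q r" "E r q'" using w w' symI by blast
    have S: "p \<in> S" "p' \<in> S" "q \<in> S" "q' \<in> S" "r \<in> S"
      using NS(1) MS(1) pq r by auto
    have "\<not> E p r" by (rule tri[of p q r]) (use S pq r in auto)
    moreover have "\<not> E p' r" by (rule tri[of p' q' r]) (use S pq r sym in auto)
    moreover have "\<not> E p p'" by (rule tri[of p x p']) (use S pq NS x(1) in auto)
    moreover have "\<not> E q q'" by (rule tri[of q r q']) (use S r in auto)
    ultimately show False
      using c6[of x p q r q' p'] S x(1) NS(2)[OF pq(1)] NS(2)[OF pq(2)]
        MS(2)[OF pq(3)] MS(2)[OF pq(4)] MS(2)[OF r(1)] pq(6,7) r * by (simp add: sym)
  qed
  \<comment> \<open>Take neighbours \<open>u'\<close>, \<open>v'\<close> of \<open>u\<close>, \<open>v\<close> in \<open>M\<close>; they are adjacent by \<open>chain\<close>. In order that \<open>v\<close>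
    and the edges \<open>x p\<close>, \<open>u u'\<close> do not form $K_1+2K_2$, the vertex \<open>p\<close> is adjacent to \<open>u'\<close>;
    likewise it is adjacent to \<open>v'\<close>, which gives a triangle.\<close>
  have rainbow: "E p u \<or> E p v \<or> E u v" if puv: "p \<in> N x" "u \<in> M" "v \<in> M" "c u \<noteq> c v" for p u v
  proof (rule ccontr)
    assume *: "\<not> ?thesis"
    obtain u' where u': "u' \<in> M" "E u u'" using twin[OF puv(2) _ puv(1)] * symI by blast
    obtain v' where v': "v' \<in> M" "E v v'" using twin[OF puv(3) _ puv(1)] * symI by blast
    have "c v' = c u" "c u' = c v"
      using cM2[of v v' u] cM2[of u u' v] cM[OF puv(2) u'] cM[OF puv(3) v'] puv u' v' by auto
    then have nadj: "\<not> E u v'" "\<not> E v u'"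
      using cM puv u' v' by metis+
    then have uv': "E u' v'"
      using chain[OF puv(2) u'(1) puv(3) v'(1) u'(2) v'(2)] * symI by blast
    have S: "p \<in> S" "u \<in> S" "v \<in> S" "u' \<in> S" "v' \<in> S"
      using NS(1) MS(1) puv u' v' by auto
    have "E p u'"
      using k2[of v x p u u'] S x(1) NS(2)[OF puv(1)] MS(2)[OF puv(2)] MS(2)[OF puv(3)] MS(2)[OF u'(1)]
        u'(2) nadj * by (simp add: sym)
    moreover have "E p v'"
      using k2[of u x p v v'] S x(1) NS(2)[OF puv(1)] MS(2)[OF puv(2)] MS(2)[OF puv(3)] MS(2)[OF v'(1)]
        v'(2) nadj * by (simp add: sym)
    ultimately show False
      using tri[of u' p v'] uv' S by (simp add: sym)
  qed
  have "cyclic_colouring E S c"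
  proof (rule cyclic_colouringI)
    show "c u < 3" for u by (simp add: c_def)
    show "c u \<noteq> c v" if "u \<in> S" "v \<in> S" "E u v" for u v using proper that .
    show "E p q' \<or> E p' q" if pq: "{p, q, p', q'} \<subseteq> S" "c p = c p'" "c q = c q'" "E p q" "E p' q'"
      for p q p' q'
    proof -
      have S: "p \<in> S" "q \<in> S" "p' \<in> S" "q' \<in> S" using pq(1) by auto
      have ne: "c p \<noteq> c q" "\<not> E p p'" "\<not> E q q'"
        using proper[OF S(1,2)] proper[OF S(1,3)] proper[OF S(2,4)] pq(2-4) by auto
      consider "c p = 1" | "c q = 1" | "c p \<noteq> 1" "c q \<noteq> 1" by blast
      then show ?thesis
      proof cases
        case 1
        then have "p \<in> N x" "p' \<in> N x" "q \<in> M" "q' \<in> M"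
          using S ne pq(2,3) by (auto simp: M_def c1[symmetric])
        from cross[OF this pq(3-5)] show ?thesis .
      next
        case 2
        then have "q \<in> N x" "q' \<in> N x" "p \<in> M" "p' \<in> M"
          using S ne pq(2,3) by (auto simp: M_def c1[symmetric])
        from cross[OF this pq(2) symI[OF pq(4)] symI[OF pq(5)]] show ?thesis
          using symI by blast
      next
        case 3
        then have M: "p \<in> M" "q \<in> M" "p' \<in> M" "q' \<in> M"
          using S pq(2,3) by (auto simp: M_def c1[symmetric])
        from chain[OF M pq(4,5)] ne show ?thesis
          by (auto simp: sym)
      qed
    qed
    show "E u v \<or> E v w \<or> E u w"
      if S: "{u, v, w} \<subseteq> S" and c: "c u \<noteq> c v" "c v \<noteq> c w" "c u \<noteq> c w" for u v w
    proof -
      consider "c u = 1" | "c v = 1" | "c w = 1"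
        using c by (auto simp: c_def split: if_splits)
      then show ?thesis
      proof cases
        case 1
        then have "u \<in> N x" "v \<in> M" "w \<in> M"
          using S c by (auto simp: M_def c1[symmetric])
        from rainbow[OF this c(2)] show ?thesis by blast
      next
        case 2
        then have "v \<in> N x" "u \<in> M" "w \<in> M"
          using S c by (auto simp: M_def c1[symmetric])
        from rainbow[OF this c(3)] symI[of v u] show ?thesis by blast
      next
        case 3
        then have "w \<in> N x" "u \<in> M" "v \<in> M"
          using S c by (auto simp: M_def c1[symmetric])
        from rainbow[OF this c(1)] symI[of w u] symI[of w v] show ?thesis by blast
      qed
    qed
  qed
  then show ?thesis by blast
qed

text \<open>
  A diagonal argument: from colourings of larger and larger finite parts of \<open>S\<close> choose a subsequence
  that becomes constant at each vertex. Its limit agrees on every finite set with one of the given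
  colourings.
\<close>

lemma colouring_compactness:
  fixes P :: "'a set \<Rightarrow> ('a \<Rightarrow> nat) \<Rightarrow> bool"
  assumes "countable S"
    and fin: "\<And>F. finite F \<Longrightarrow> F \<subseteq> S \<Longrightarrow> \<exists>c. (\<forall>x\<in>F. c x < k) \<and> P F c"
    and local: "\<And>F F' c c'. F \<subseteq> F' \<Longrightarrow> P F' c \<Longrightarrow> (\<And>x. x \<in> F \<Longrightarrow> c x = c' x) \<Longrightarrow> P F c'"
  shows "\<exists>c. \<forall>F. finite F \<longrightarrow> F \<subseteq> S \<longrightarrow> P F c"
proof -
  define F where "F n = {x \<in> S. to_nat_on S x < n}" for n
  have inj: "inj_on (to_nat_on S) S"
    using assms(1) by (rule inj_on_to_nat_on)
  have "finite (F n)" for n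
    by (rule inj_on_finite[of "to_nat_on S" _ "{..<n}"])
       (auto simp: F_def intro: inj_on_subset[OF inj])
  then have "\<exists>c. (\<forall>x\<in>F n. c x < k) \<and> P (F n) c" for n
    by (intro fin) (auto simp: F_def)
  then obtain c where c: "\<And>n x. x \<in> F n \<Longrightarrow> c n x < k" "\<And>n. P (F n) (c n)"
    by metis
  \<comment> \<open>Convergence of bounded sequences is applied to real numbers; a convergent sequence of
    integers is eventually constant.\<close>
  define g where "g n x = (if x \<in> F n then real (c n x) else 0)" for n x
  have "norm (g n x) \<le> real k" for n x
    using c(1)[of x n] by (auto simp: g_def)
  then obtain s where s: "strict_mono s" "\<And>x. x \<in> S \<Longrightarrow> \<exists>l. (\<lambda>n. g (s n) x) \<longlonglongrightarrow> l"
    using function_convergent_subsequence[OF assms(1), of g "real k"] by blast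
  have "\<exists>m. \<forall>\<^sub>F n in sequentially. x \<in> F (s n) \<and> c (s n) x = m" if x: "x \<in> S" for x
  proof -
    obtain l where l: "(\<lambda>n. g (s n) x) \<longlonglongrightarrow> l" using s(2)[OF x] by blast
    have F: "\<forall>\<^sub>F n in sequentially. x \<in> F (s n)"
      using eventually_compose_filterlim[OF eventually_gt_at_top filterlim_subseq[OF s(1)], of "to_nat_on S x"] x
      by (simp add: F_def)
    have "\<forall>\<^sub>F n in sequentially. x \<in> F (s n) \<and> dist (g (s n) x) l < 1 / 2"
      using F tendstoD[OF l, of "1/2"] by (simp add: eventually_conj)
    then obtain n0 where n0: "\<And>n. n \<ge> n0 \<Longrightarrow> x \<in> F (s n) \<and> dist (g (s n) x) l < 1 / 2"
      by (auto simp: eventually_sequentially)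
    have "c (s n) x = c (s n0) x" if "n \<ge> n0" for n
    proof -
      have "\<bar>real (c (s n) x) - l\<bar> < 1 / 2" "\<bar>real (c (s n0) x) - l\<bar> < 1 / 2"
        using n0[OF that] n0[of n0] by (auto simp: g_def dist_real_def)
      then show ?thesis by linarith
    qed
    with n0 show ?thesis by (auto simp: eventually_sequentially)
  qed
  then obtain d where d: "\<And>x. x \<in> S \<Longrightarrow> \<forall>\<^sub>F n in sequentially. x \<in> F (s n) \<and> c (s n) x = d x"
    by metis
  have "P F' d" if "finite F'" "F' \<subseteq> S" for F'
  proof -
    have "\<forall>\<^sub>F n in sequentially. \<forall>x\<in>F'. x \<in> F (s n) \<and> c (s n) x = d x"
      using that d by (auto intro!: eventually_ball_finite)
    then obtain n where n: "\<forall>x\<in>F'. x \<in> F (s n) \<and> c (s n) x = d x"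
      using eventually_happens'[OF sequentially_bot] by blast
    show ?thesis
      by (rule local[OF _ c(2)[of "s n"]]) (use n in auto)
  qed
  then show ?thesis by blast
qed

lemma cyclic_colouring_countable:
  assumes "countable S" "pattern_free E S" "\<And>u v. E u v \<longleftrightarrow> E v u"
  shows "\<exists>c. cyclic_colouring E S c"
proof -
  have "\<exists>c. \<forall>F. finite F \<longrightarrow> F \<subseteq> S \<longrightarrow> cyclic_colouring E F c"
  proof (rule colouring_compactness[OF assms(1), where k = 3])
    fix F assume F: "finite F" "F \<subseteq> S"
    obtain c where "cyclic_colouring E F c"
      using finite_cyclic_colouring[OF F(1) pattern_free_subset[OF assms(2) F(2)] assms(3)] by blast
    with cyclic_colouringD(1)[OF this] show "\<exists>c. (\<forall>x\<in>F. c x < 3) \<and> cyclic_colouring E F c"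
      by blast
  next
    fix F F' and c c' :: "'a \<Rightarrow> nat"
    assume F: "F \<subseteq> F'" and c: "cyclic_colouring E F' c" and eq: "\<And>x. x \<in> F \<Longrightarrow> c x = c' x"
    show "cyclic_colouring E F c'"
    proof (rule cyclic_colouringI)
      show "c' x < 3" if "x \<in> F" for x
        using cyclic_colouringD(1)[OF c, of x] F eq that by auto
      show "c' x \<noteq> c' y" if "x \<in> F" "y \<in> F" "E x y" for x y
        using cyclic_colouringD(2)[OF c, of x y] F eq that by auto
      show "E a b' \<or> E a' b"
        if "{a, b, a', b'} \<subseteq> F" "c' a = c' a'" "c' b = c' b'" "E a b" "E a' b'" for a b a' b'
        using cyclic_colouringD(3)[OF c, of a b a' b'] F eq that by auto
      show "E x y \<or> E y z \<or> E x z"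
        if "{x, y, z} \<subseteq> F" "c' x \<noteq> c' y" "c' y \<noteq> c' z" "c' x \<noteq> c' z" for x y z
        using cyclic_colouringD(4)[OF c, of x y z] F eq that by auto
    qed
  qed
  then obtain c where c: "\<And>F. finite F \<Longrightarrow> F \<subseteq> S \<Longrightarrow> cyclic_colouring E F c"
    by blast
  have "cyclic_colouring E S c"
  proof (rule cyclic_colouringI)
    show "c x < 3" if "x \<in> S" for x
      using cyclic_colouringD(1)[OF c, of "{x}" x] that by simp
    show "c x \<noteq> c y" if "x \<in> S" "y \<in> S" "E x y" for x y
      using cyclic_colouringD(2)[OF c, of "{x, y}" x y] that by simp
    show "E a b' \<or> E a' b"
      if "{a, b, a', b'} \<subseteq> S" "c a = c a'" "c b = c b'" "E a b" "E a' b'" for a b a' b'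
      using cyclic_colouringD(3)[OF c, of "{a, b, a', b'}" a b a' b'] that by simp
    show "E x y \<or> E y z \<or> E x z"
      if "{x, y, z} \<subseteq> S" "c x \<noteq> c y" "c y \<noteq> c z" "c x \<noteq> c z" for x y z
      using cyclic_colouringD(4)[OF c, of "{x, y, z}" x y z] that by simp
  qed
  then show ?thesis by blast
qed

section \<open>From cyclic colourings to orders\<close>

text \<open>
  Every relation between elements of different colours that follows from \<open>A\<close> by transitivity already
  belongs to \<open>A\<close>, so the transitive closure only adds pairs of the same colour, and for these a
  single intermediate element is enough. Each case of transitivity is an instance of the absence of
  short cycles.
\<close>

lemma tournament_order:
  fixes S :: "'a set" and c :: "'a \<Rightarrow> 'b" and A :: "'a \<Rightarrow> 'a \<Rightarrow> bool"
  assumes col: "\<And>x y. x \<in> S \<Longrightarrow> y \<in> S \<Longrightarrow> A x y \<Longrightarrow> c x \<noteq> c y"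
    and asym: "\<And>x y. x \<in> S \<Longrightarrow> y \<in> S \<Longrightarrow> A x y \<Longrightarrow> \<not> A y x"
    and tot: "\<And>x y. x \<in> S \<Longrightarrow> y \<in> S \<Longrightarrow> c x \<noteq> c y \<Longrightarrow> A x y \<or> A y x"
    and c3: "\<And>x y z. x \<in> S \<Longrightarrow> y \<in> S \<Longrightarrow> z \<in> S \<Longrightarrow> c x \<noteq> c z \<Longrightarrow> A x y \<Longrightarrow> A y z \<Longrightarrow> A x z"
    and c4: "\<And>x y z w. x \<in> S \<Longrightarrow> y \<in> S \<Longrightarrow> z \<in> S \<Longrightarrow> w \<in> S \<Longrightarrow> c x = c z \<Longrightarrow> c y = c w \<Longrightarrow>
      A x y \<Longrightarrow> A y z \<Longrightarrow> A z w \<Longrightarrow> A x w"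
  obtains prec where "\<And>x. x \<in> S \<Longrightarrow> \<not> prec x x"
    "\<And>x y z. x \<in> S \<Longrightarrow> y \<in> S \<Longrightarrow> z \<in> S \<Longrightarrow> prec x y \<Longrightarrow> prec y z \<Longrightarrow> prec x z"
    "\<And>x y. A x y \<Longrightarrow> prec x y"
proof -
  define prec where "prec x y \<longleftrightarrow> A x y \<or> (c x = c y \<and> (\<exists>z\<in>S. A x z \<and> A z y))" for x y
  have irrefl: "\<not> prec x x" if "x \<in> S" for x
    using that asym col unfolding prec_def by blast
  have R: "A x z" if "x \<in> S" "y \<in> S" "z \<in> S" "w \<in> S" "A x y" "A y w" "A w z" "c y = c z" for x y z w
  proof (cases "c x = c w")
    case True
    then show ?thesis using c4[of x y w z] that by auto
  next
    case False
    then have "A x w" using c3[of x y w] that by auto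
    then show ?thesis using c3[of x w z] col[of x y] that by auto
  qed
  have L: "A x z" if "x \<in> S" "y \<in> S" "z \<in> S" "w \<in> S" "A x w" "A w y" "A y z" "c x = c y" for x y z w
  proof (cases "c w = c z")
    case True
    then show ?thesis using c4[of x w y z] that by auto
  next
    case False
    then have "A w z" using c3[of w y z] that by auto
    then show ?thesis using c3[of x w z] col[of y z] that by auto
  qed
  have trans: "prec x z" if S: "x \<in> S" "y \<in> S" "z \<in> S" and "prec x y" "prec y z" for x y z
  proof -
    consider (a) "A x y" "A y z" | (b) w where "A x y" "c y = c z" "w \<in> S" "A y w" "A w z"
      | (c) w where "c x = c y" "w \<in> S" "A x w" "A w y" "A y z"
      | (d) w w' where "c x = c y" "w \<in> S" "A x w" "A w y" "c y = c z" "w' \<in> S" "A y w'" "A w' z"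
      using \<open>prec x y\<close> \<open>prec y z\<close> unfolding prec_def by blast
    then show ?thesis
    proof cases
      case a
      then show ?thesis using c3[OF S] S unfolding prec_def by blast
    next
      case b
      then show ?thesis using R[of x y z w] S unfolding prec_def by blast
    next
      case c
      then show ?thesis using L[of x y z w] S unfolding prec_def by blast
    next
      case d
      then have "A w z" using R[of w y z w'] S by blast
      then show ?thesis using d S unfolding prec_def by auto
    qed
  qed
  show thesis
    by (rule that[of prec]) (fact irrefl, fact trans, simp add: prec_def)
qed

text \<open>
  The order of the positions within their arcs that the adjacencies force on two points of different
  arcs.
\<close>

definition circle_before :: "('a \<Rightarrow> 'a \<Rightarrow> bool) \<Rightarrow> ('a \<Rightarrow> nat) \<Rightarrow> 'a \<Rightarrow> 'a \<Rightarrow> bool" where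
  "circle_before E c u v \<longleftrightarrow>
     (c v = (c u + 1) mod 3 \<and> E u v) \<or> (c u = (c v + 1) mod 3 \<and> \<not> E u v)"

text \<open>
  A directed 3-cycle of this relation runs through the colours either upwards, and is then a triangle,
  or downwards, and is then a rainbow independent triple. Of the four pairs in a directed 4-cycle on
  two colours every second one is an edge, which gives $2K_2$.
\<close>

lemma cyclic_colouring_order:
  assumes free: "triangle_free E S" and col: "cyclic_colouring E S c"
    and sym: "\<And>u v. E u v \<longleftrightarrow> E v u"
  obtains prec where "\<And>x. x \<in> S \<Longrightarrow> \<not> prec x x"
    "\<And>x y z. x \<in> S \<Longrightarrow> y \<in> S \<Longrightarrow> z \<in> S \<Longrightarrow> prec x y \<Longrightarrow> prec y z \<Longrightarrow> prec x z"
    "\<And>x y. x \<in> S \<Longrightarrow> y \<in> S \<Longrightarrow> circle_before E c x y \<Longrightarrow> prec x y"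
proof -
  define A where "A = circle_before E c"
  define nxt where "nxt i = (i + 1) mod 3" for i :: nat
  have A: "A u v \<longleftrightarrow> (c v = nxt (c u) \<and> E u v) \<or> (c u = nxt (c v) \<and> \<not> E u v)" for u v
    by (simp add: A_def circle_before_def nxt_def)
  have c: "c u = 0 \<or> c u = 1 \<or> c u = 2" if "u \<in> S" for u
    using cyclic_colouringD(1)[OF col that] by linarith
  have nxt [simp]: "nxt 0 = 1" "nxt (Suc 0) = 2" "nxt 2 = 0"
    by (auto simp: nxt_def)
  have ne: "c u \<noteq> c v" if "u \<in> S" "v \<in> S" "A u v" for u v
    using c[OF that(1)] c[OF that(2)] that(3) by (elim disjE; simp add: A)
  have asym: "\<not> A v u" if "u \<in> S" "v \<in> S" "A u v" for u v
    using c[OF that(1)] c[OF that(2)] that(3) sym[of u v] by (elim disjE; simp add: A)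
  have tot: "A u v \<or> A v u" if "u \<in> S" "v \<in> S" "c u \<noteq> c v" for u v
    using c[OF that(1)] c[OF that(2)] that(3) sym[of u v] by (elim disjE; simp add: A)
  have c3: "A u w" if S: "u \<in> S" "v \<in> S" "w \<in> S" and "c u \<noteq> c w" "A u v" "A v w" for u v w
  proof (rule ccontr)
    assume "\<not> A u w"
    then have wu: "A w u" using tot[OF S(1,3) that(4)] by blast
    have "\<not> (E u v \<and> E v w \<and> E u w)"
      using free[unfolded triangle_free_def, rule_format, of u v w] S by simp
    moreover have "E u v \<or> E v w \<or> E u w"
      using cyclic_colouringD(4)[OF col, of u v w] S that(4) ne[OF S(1,2) that(5)] ne[OF S(2,3) that(6)]
      by simp
    ultimately show False
      using c[OF S(1)] c[OF S(2)] c[OF S(3)] \<open>A u v\<close> \<open>A v w\<close> wu that(4) sym[of u w]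
      by (elim disjE; simp add: A)
  qed
  have c4: "A u t" if S: "u \<in> S" "v \<in> S" "w \<in> S" "t \<in> S" and cc: "c u = c w" "c v = c t"
    and AA: "A u v" "A v w" "A w t" for u v w t
  proof -
    have 1: "E u v \<Longrightarrow> E w t \<Longrightarrow> E u t \<or> E w v"
      using cyclic_colouringD(3)[OF col, of u v w t] S cc by simp
    have 2: "E u t \<Longrightarrow> E w v \<Longrightarrow> E u v \<or> E w t"
      using cyclic_colouringD(3)[OF col, of u t w v] S cc by simp
    have nn: "c u \<noteq> nxt (c v)" if "c v = nxt (c u)"
      using c[OF S(1)] that by auto
    show ?thesis
    proof (cases "c v = nxt (c u)")
      case True
      then have "E u v" "\<not> E w v" "E w t"
        using AA nn cc sym[of w v] by (simp_all add: A)
      with 1 True cc show ?thesis by (simp add: A)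
    next
      case False
      then have "c u = nxt (c v)" "\<not> E u v" "E w v" "\<not> E w t"
        using AA cc sym[of w v] by (auto simp: A)
      with 2 cc show ?thesis by (auto simp: A)
    qed
  qed
  show thesis
  proof (rule tournament_order[of S A c])
    fix prec
    assume "\<And>x. x \<in> S \<Longrightarrow> \<not> prec x x"
      "\<And>x y z. x \<in> S \<Longrightarrow> y \<in> S \<Longrightarrow> z \<in> S \<Longrightarrow> prec x y \<Longrightarrow> prec y z \<Longrightarrow> prec x z"
      "\<And>x y. A x y \<Longrightarrow> prec x y"
    then show thesis
      by (rule that[unfolded A_def[symmetric]])
  qed (fact ne asym tot c3 c4)+
qed

section \<open>Placing the vertices on the circle\<close>

text \<open>
  The elements are placed in the order of an enumeration of \<open>S\<close>. If \<open>y\<close> and \<open>z\<close> are already placed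
  and \<open>y\<close> precedes \<open>x\<close> and \<open>x\<close> precedes \<open>z\<close>, then \<open>y\<close> precedes \<open>z\<close> by transitivity, so \<open>f y < f z\<close>;
  hence some interval remains for \<open>x\<close>. The sets \<open>D x\<close> may depend on \<open>x\<close>, because vertices of
  different colours use different arcs of the given set of points.
\<close>

lemma countable_order_into_dense:
  fixes S :: "'a set" and prec :: "'a \<Rightarrow> 'a \<Rightarrow> bool" and D :: "'a \<Rightarrow> real set"
  assumes "countable S" and lh: "l < h"
    and dense: "\<And>x a b. x \<in> S \<Longrightarrow> l \<le> a \<Longrightarrow> a < b \<Longrightarrow> b \<le> h \<Longrightarrow> \<exists>t\<in>D x. a < t \<and> t < b"
    and irrefl: "\<And>x. x \<in> S \<Longrightarrow> \<not> prec x x"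
    and trans: "\<And>x y z. x \<in> S \<Longrightarrow> y \<in> S \<Longrightarrow> z \<in> S \<Longrightarrow> prec x y \<Longrightarrow> prec y z \<Longrightarrow> prec x z"
  obtains f where "inj_on f S" "\<And>x. x \<in> S \<Longrightarrow> f x \<in> D x \<and> l < f x \<and> f x < h"
    "\<And>x y. x \<in> S \<Longrightarrow> y \<in> S \<Longrightarrow> prec x y \<Longrightarrow> f x < f y"
proof -
  define e where "e = to_nat_on S"
  have e: "inj_on e S"
    using assms(1) by (auto simp: e_def)
  define P where "P f x t \<longleftrightarrow> (x \<in> S \<longrightarrow> t \<in> D x \<and> l < t \<and> t < h \<and>
     (\<forall>y\<in>S. e y < e x \<longrightarrow> f y \<noteq> t \<and> (prec y x \<longrightarrow> f y < t) \<and> (prec x y \<longrightarrow> t < f y)))"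
    for f :: "'a \<Rightarrow> real" and x t
  have "\<exists>f. \<forall>x. P f x (f x)"
  proof (rule dependent_wf_choice[OF wf_measure[of e]])
    fix f g :: "'a \<Rightarrow> real" and x t
    assume "\<And>z. (z, x) \<in> Wellfounded.measure e \<Longrightarrow> f z = g z"
    then show "P f x t = P g x t"
      by (auto simp: P_def)
  next
    fix x f
    assume "\<And>y. (y, x) \<in> Wellfounded.measure e \<Longrightarrow> P f y (f y)"
    then have IH: "P f y (f y)" if "e y < e x" for y
      using that by auto
    show "\<exists>t. P f x t"
    proof (cases "x \<in> S")
      case True
      define B where "B = {y \<in> S. e y < e x}"
      have "finite (e ` B)"
        by (rule finite_subset[of _ "{..<e x}"]) (auto simp: B_def)
      then have B: "finite B"
        by (rule finite_imageD) (auto simp: B_def intro: inj_on_subset[OF e])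
      have Bf: "l < f y \<and> f y < h" if "y \<in> B" for y
        using IH[of y] that by (auto simp: P_def B_def)
      have mono: "f y < f z" if yz: "y \<in> B" "z \<in> B" "prec y z" for y z
      proof -
        have "e y \<noteq> e z"
          using inj_onD[OF e, of y z] irrefl yz by (auto simp: B_def)
        then consider "e y < e z" | "e z < e y" by linarith
        then show ?thesis
          using IH[of y] IH[of z] yz by cases (auto simp: P_def B_def)
      qed
      \<comment> \<open>The minimum \<open>b\<close> is over all earlier values above \<open>a\<close>, not only those of elements above \<open>x\<close>: the
        open interval between \<open>a\<close> and \<open>b\<close> then contains no earlier value, which gives injectivity.\<close>
      define a where "a = Max (insert l (f ` {y \<in> B. prec y x}))"
      define b where "b = Min (insert h (f ` {y \<in> B. a < f y}))"
      have a: "l \<le> a" "\<And>y. y \<in> B \<Longrightarrow> prec y x \<Longrightarrow> f y \<le> a" "a < h"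
        using B Bf lh by (auto simp: a_def)
      have b: "b \<le> h" "\<And>y. y \<in> B \<Longrightarrow> a < f y \<Longrightarrow> b \<le> f y" "a < b"
        using B a(3) by (auto simp: b_def)
      have up: "a < f z" if "z \<in> B" "prec x z" for z
      proof -
        have "f y < f z" if "y \<in> B" "prec y x" for y
          using mono[of y z] trans[of y x z] that \<open>z \<in> B\<close> \<open>prec x z\<close> True by (auto simp: B_def)
        then show ?thesis
          using B Bf[OF that(1)] by (auto simp: a_def)
      qed
      obtain t where t: "t \<in> D x" "a < t" "t < b"
        using dense[OF True a(1) b(3) b(1)] by blast
      have "P f x t"
        unfolding P_def
      proof (intro impI conjI ballI)
        fix y assume "y \<in> S" "e y < e x"
        then have y: "y \<in> B" by (simp add: B_def)
        show "f y \<noteq> t" using b(2)[OF y] t by fastforce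
        show "f y < t" if "prec y x" using a(2)[OF y that] t by simp
        show "t < f y" if "prec x y" using b(2)[OF y up[OF y that]] t by simp
      qed (use t a b in auto)
      then show ?thesis by blast
    qed (simp add: P_def)
  qed
  then obtain f where f: "\<And>x. P f x (f x)" by blast
  have ee: "e x < e y \<or> e y < e x" if "x \<in> S" "y \<in> S" "x \<noteq> y" for x y
    using inj_onD[OF e, of x y] that by fastforce
  show thesis
  proof
    show "inj_on f S"
    proof (rule inj_onI, rule ccontr)
      fix x y assume "x \<in> S" "y \<in> S" "f x = f y" "x \<noteq> y"
      then show False
        using ee[of x y] f[of x] f[of y] by (auto simp: P_def)
    qed
    show "f x \<in> D x \<and> l < f x \<and> f x < h" if "x \<in> S" for x
      using f[of x] that by (auto simp: P_def)
    show "f x < f y" if "x \<in> S" "y \<in> S" "prec x y" for x y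
      using ee[of x y] f[of x] f[of y] that irrefl[of x] by (auto simp: P_def)
  qed
qed

lemma Arg2pi_cis: "0 \<le> t \<Longrightarrow> t < 2 * pi \<Longrightarrow> Arg2pi (cis t) = t"
  by (rule Arg2pi_unique[of 1]) (auto simp: cis_conv_exp)

text \<open>
  Points of \<open>V\<close> close to the midpoint of the arc lie inside the arc, because the argument is
  continuous away from the nonnegative reals.
\<close>

lemma angle_dense:
  assumes "sphere 0 1 \<subseteq> closure V" "V \<subseteq> sphere 0 1" "0 \<le> a" "a < b" "b \<le> 2 * pi"
  shows "\<exists>t. a < t \<and> t < b \<and> cis t \<in> V"
proof -
  define m where "m = (a + b) / 2"
  have m: "a < m" "m < b" "0 < m" "m < 2 * pi"
    using assms by (auto simp: m_def)
  have Am: "Arg2pi (cis m) = m"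
    using m by (simp add: Arg2pi_cis)
  have "cis m \<notin> \<real>\<^sub>\<ge>\<^sub>0"
    using m Am Arg2pi_eq_0[of "cis m"] by (auto simp: complex_nonneg_Reals_iff complex_is_Real_iff)
  then have "isCont Arg2pi (cis m)"
    by (rule continuous_at_Arg2pi)
  then obtain d where d: "d > 0" "\<And>z. dist z (cis m) < d \<Longrightarrow> dist (Arg2pi z) m < (b - a) / 2"
    using assms(4) Am unfolding continuous_at_eps_delta by (metis diff_gt_0_iff_gt half_gt_zero)
  obtain v where v: "v \<in> V" "dist v (cis m) < d"
    using d(1) assms(1) closure_approachable[of "cis m" V] by (auto simp: subset_iff)
  have "cis (Arg2pi v) = v"
    using v(1) assms(2) complex_norm_eq_1_exp[of v] by (auto simp: cis_conv_exp)
  moreover have "a < Arg2pi v" "Arg2pi v < b"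
    using d(2)[OF v(2)] by (auto simp: dist_real_def m_def field_simps abs_if split: if_splits)
  ultimately show ?thesis
    using v(1) by (intro exI[of _ "Arg2pi v"]) auto
qed

lemma circle_edge_iff:
  assumes "0 \<le> s" "s < 2 * pi" "0 \<le> t" "t < 2 * pi" "cis s \<in> V" "cis t \<in> V"
  shows "{cis s, cis t} \<in> edges (circle_graph V) \<longleftrightarrow> 2 * pi / 3 < \<bar>s - t\<bar> \<and> \<bar>s - t\<bar> < 4 * pi / 3"
proof -
  have *: "{cis s, cis t} \<in> edges (circle_graph V) \<longleftrightarrow> 2 * pi / 3 < t - s \<and> t - s < 4 * pi / 3"
    if st: "0 \<le> s" "s < t" "t < 2 * pi" "cis s \<in> V" "cis t \<in> V" for s t
  proof -
    have 1: "arc_len (cis s) (cis t) = t - s"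
      using st by (simp add: arc_len_def cis_divide Arg2pi_cis)
    have "cis (s - t) = cis (2 * pi - (t - s))"
      by (simp add: complex_eq_iff cos_diff sin_diff)
    then have 2: "arc_len (cis t) (cis s) = 2 * pi - (t - s)"
      using st by (simp add: arc_len_def cis_divide Arg2pi_cis)
    have "cis s \<noteq> cis t"
      using st Arg2pi_cis[of s] Arg2pi_cis[of t] by auto
    then have "{cis s, cis t} \<in> edges (circle_graph V) \<longleftrightarrow>
        arc_len (cis s) (cis t) > 2 * pi / 3 \<and> arc_len (cis t) (cis s) > 2 * pi / 3"
      using st unfolding circle_graph_def by (auto simp: doubleton_eq_iff)
    then show ?thesis unfolding 1 2 by auto
  qed
  consider "s < t" | "t < s" | "s = t" by linarith
  then show ?thesis
  proof cases
    case 1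
    with *[of s t] assms show ?thesis by auto
  next
    case 2
    with *[of t s] assms show ?thesis by (auto simp: insert_commute)
  next
    case 3
    then show ?thesis by (auto simp: circle_graph_def doubleton_eq_iff)
  qed
qed

lemma circle_realisation:
  assumes V: "V \<subseteq> sphere 0 1" "sphere 0 1 \<subseteq> closure V"
    and "countable S" "triangle_free E S" and col: "cyclic_colouring E S c"
    and sym: "\<And>u v. E u v \<longleftrightarrow> E v u"
  obtains g where "inj_on g S" "g ` S \<subseteq> V"
    "\<And>u v. u \<in> S \<Longrightarrow> v \<in> S \<Longrightarrow> {g u, g v} \<in> edges (circle_graph V) \<longleftrightarrow> E u v"
proof -
  obtain prec where prec: "\<And>x. x \<in> S \<Longrightarrow> \<not> prec x x"
    "\<And>x y z. x \<in> S \<Longrightarrow> y \<in> S \<Longrightarrow> z \<in> S \<Longrightarrow> prec x y \<Longrightarrow> prec y z \<Longrightarrow> prec x z"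
    "\<And>x y. x \<in> S \<Longrightarrow> y \<in> S \<Longrightarrow> circle_before E c x y \<Longrightarrow> prec x y"
    using cyclic_colouring_order[OF assms(4) col sym] by blast
  define p where "p = 2 * pi / 3"
  have p: "p > 0" "2 * pi = 3 * p" "4 * pi / 3 = 2 * p" "2 * pi / 3 = p"
    by (auto simp: p_def)
  have c: "c u = 0 \<or> c u = 1 \<or> c u = 2" if "u \<in> S" for u
    using cyclic_colouringD(1)[OF col that] by linarith
  define D where "D u = {t. cis (t + p * c u) \<in> V}" for u
  have dense: "\<exists>t\<in>D u. a < t \<and> t < b" if u: "u \<in> S" and ab: "0 \<le> a" "a < b" "b \<le> p" for u a b
  proof -
    have "0 \<le> a + p * c u" "a + p * c u < b + p * c u" "b + p * c u \<le> 2 * pi"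
      using c[OF u] ab p by auto
    from angle_dense[OF V(2,1) this] obtain t where "a + p * c u < t" "t < b + p * c u" "cis t \<in> V"
      by blast
    then show ?thesis
      by (intro bexI[of _ "t - p * c u"]) (auto simp: D_def)
  qed
  obtain f where inj: "inj_on f S" and f: "\<And>u. u \<in> S \<Longrightarrow> f u \<in> D u \<and> 0 < f u \<and> f u < p"
    and mono: "\<And>u v. u \<in> S \<Longrightarrow> v \<in> S \<Longrightarrow> prec u v \<Longrightarrow> f u < f v"
    using countable_order_into_dense[OF assms(3) p(1), of D prec] dense prec(1,2) by blast
  define \<theta> where "\<theta> u = f u + p * c u" for u
  have \<theta>: "0 \<le> \<theta> u" "\<theta> u < 2 * pi" "cis (\<theta> u) \<in> V" if "u \<in> S" for u
    using f[OF that] c[OF that] p by (auto simp: \<theta>_def D_def)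
  have before: "circle_before E c u v \<Longrightarrow> f u < f v" if "u \<in> S" "v \<in> S" for u v
    using mono prec(3) that by blast
  have edge: "E u v \<longleftrightarrow> p < \<bar>\<theta> u - \<theta> v\<bar> \<and> \<bar>\<theta> u - \<theta> v\<bar> < 2 * p" if S: "u \<in> S" "v \<in> S" for u v
  proof -
    have step: "E u v \<longleftrightarrow> p < \<bar>\<theta> u - \<theta> v\<bar> \<and> \<bar>\<theta> u - \<theta> v\<bar> < 2 * p"
      if cc: "c v = (c u + 1) mod 3" and S: "u \<in> S" "v \<in> S" for u v
    proof -
      have "E u v \<longleftrightarrow> f u < f v"
        using before[OF S] before[OF S(2,1)] cc sym[of v u] by (auto simp: circle_before_def)
      \<comment> \<open>The second alternative occurs for the colours 2 and 0, where the angle wraps around.\<close>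
      moreover have "\<theta> v - \<theta> u = p + (f v - f u) \<or> \<theta> u - \<theta> v = 2 * p - (f v - f u)"
        using c[OF S(1)] cc by (elim disjE) (simp_all add: \<theta>_def)
      ultimately show ?thesis
        using f[OF S(1)] f[OF S(2)] by (auto simp: abs_if)
    qed
    consider "c u = c v" | "c v = (c u + 1) mod 3" | "c u = (c v + 1) mod 3"
      using c[OF S(1)] c[OF S(2)] by (elim disjE) simp_all
    then show ?thesis
    proof cases
      case 1
      then have "\<bar>\<theta> u - \<theta> v\<bar> < p"
        using f[OF S(1)] f[OF S(2)] by (auto simp: \<theta>_def)
      moreover have "\<not> E u v"
        using cyclic_colouringD(2)[OF col S] 1 by blast
      ultimately show ?thesis by simp
    next
      case 2
      from step[OF this S] show ?thesis .
    next
      case 3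
      from step[OF this S(2,1)] show ?thesis
        unfolding sym[of u v] abs_minus_commute[of "\<theta> u"] .
    qed
  qed
  show thesis
  proof (rule that[of "\<lambda>u. cis (\<theta> u)"])
    show "inj_on (\<lambda>u. cis (\<theta> u)) S"
    proof (rule inj_onI)
      fix u v assume S: "u \<in> S" "v \<in> S" and eq: "cis (\<theta> u) = cis (\<theta> v)"
      have "\<theta> u = Arg2pi (cis (\<theta> u))"
        by (rule Arg2pi_cis[OF \<theta>(1,2)[OF S(1)], symmetric])
      also have "\<dots> = \<theta> v"
        unfolding eq by (rule Arg2pi_cis[OF \<theta>(1,2)[OF S(2)]])
      finally have "\<theta> u = \<theta> v" .
      then have "f u = f v"
        using c[OF S(1)] c[OF S(2)] f[OF S(1)] f[OF S(2)] by (auto simp: \<theta>_def)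
      from inj_onD[OF inj this S] show "u = v" .
    qed
    show "{cis (\<theta> u), cis (\<theta> v)} \<in> edges (circle_graph V) \<longleftrightarrow> E u v" if "u \<in> S" "v \<in> S" for u v
      unfolding circle_edge_iff[OF \<theta>(1,2)[OF that(1)] \<theta>(1,2)[OF that(2)] \<theta>(3)[OF that(1)] \<theta>(3)[OF that(2)]]
      using edge[OF that] by (simp add: p)
  qed (use \<theta> in auto)
qed

theorem corollary44:
  fixes G :: "'a sgraph" and V :: "complex set"
  assumes "rational_circle_set V"
    and "simple_graph G"
    and "countable (verts G)"
    and "free_of {complete_graph 3,
                  complete_graph 1 \<uplus> (complete_graph 2 \<uplus> complete_graph 2),
                  complete_graph 1 \<uplus> cycle_graph 5,
                  cycle_graph 6} G"
  shows "embeds G (circle_graph V)"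
proof -
  let ?E = "\<lambda>u v. {u, v} \<in> edges G"
  have sym: "?E u v \<longleftrightarrow> ?E v u" for u v
    by (simp add: insert_commute)
  have free: "pattern_free ?E (verts G)"
    by (rule pattern_free_edges[OF assms(2,4)])
  obtain c where c: "cyclic_colouring ?E (verts G) c"
    using cyclic_colouring_countable[OF assms(3) free sym] by blast
  have tri: "triangle_free ?E (verts G)"
    using free by (simp add: pattern_free_def)
  have V: "V \<subseteq> sphere 0 1" "sphere 0 1 \<subseteq> closure V"
    using assms(1) by (auto simp: rational_circle_set_def)
  show ?thesis
  proof (rule circle_realisation[OF V assms(3) tri c sym])
    fix g :: "'a \<Rightarrow> complex"
    assume g: "inj_on g (verts G)" "g ` verts G \<subseteq> V"
      "\<And>u v. u \<in> verts G \<Longrightarrow> v \<in> verts G \<Longrightarrow> {g u, g v} \<in> edges (circle_graph V) \<longleftrightarrow> ?E u v"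
    show ?thesis
      by (rule embedsI[OF g(1)]) (use g(2,3) in \<open>auto simp: circle_graph_def\<close>)
  qed
qed

end
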